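(* Let $0\le q<p\le 1$. For all integers $L>n\ge 0$, the restricted partition function is $$\begin{Bmatrix}L\\ n+1\end{Bmatrix}_{p,q}=\sum_{j=0}^{n}\frac{(-1)^{n-j}}{j!\,(n-j)!}\,\frac{(1+jp+(n-j)q)^{L-1}}{(p-q)^n}.$$
   Context: $\Omega_{L,n}$ is the set of words $\tau=(\tau_1,\dots,\tau_L)$ with letters in $\{0,1,\hat 1\}$ containing exactly one $\hat 1$, exactly $n$ letters $1$ and $L-n-1$ letters $0$. For $\tau\in\Omega_{L,n}$ with $\tau_1=\hat 1$ set $$w(\tau)=\prod_{\substack{2\le i\le L\\ \tau_i=0}}\bigl(1+p\,m_i(\tau)+q\,n_i(\tau)\bigr),$$ where $m_i(\tau)$ (resp. $n_i(\tau)$) is the number of $1$'s among $\tau_2,\dots,\tau_{i-1}$ (resp. among $\tau_{i+1},\dots,\tau_L$). The restricted partition function is $$\begin{Bmatrix}L\\ n+1\end{Bmatrix}_{p,q}=\sum_{\tau\in\Omega_{L,n},\ \tau_1=\hat 1}w(\tau)\qquad(0\le n\le L-1).$$ *)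

theory Defs
  imports Complex_Main
begin

datatype letter = Zero | One | Hat

text \<open>
  Words are lists. Positions in the informal definitions start at 1, list indices at 0;
  \<open>letter_at \<tau> i\<close> is the letter written \<open>\<tau>\<^sub>i\<close>, for \<open>1 \<le> i \<le> length \<tau>\<close>.
\<close>

definition letter_at :: "letter list \<Rightarrow> nat \<Rightarrow> letter" where
  "letter_at \<tau> i = \<tau> ! (i - 1)"

definition Omega :: "nat \<Rightarrow> nat \<Rightarrow> letter list set" where
  "Omega L n = {\<tau>. length \<tau> = L \<and> count_list \<tau> Hat = 1 \<and> count_list \<tau> One = n
                    \<and> count_list \<tau> Zero = L - n - 1}"

definition ones_before :: "letter list \<Rightarrow> nat \<Rightarrow> nat" where
  "ones_before \<tau> i = card {k. 2 \<le> k \<and> k \<le> i - 1 \<and> letter_at \<tau> k = One}"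

definition ones_after :: "letter list \<Rightarrow> nat \<Rightarrow> nat" where
  "ones_after \<tau> i = card {k. i + 1 \<le> k \<and> k \<le> length \<tau> \<and> letter_at \<tau> k = One}"

definition weight :: "real \<Rightarrow> real \<Rightarrow> letter list \<Rightarrow> real" where
  "weight p q \<tau> =
     (\<Prod>i | 2 \<le> i \<and> i \<le> length \<tau> \<and> letter_at \<tau> i = Zero.
        1 + p * real (ones_before \<tau> i) + q * real (ones_after \<tau> i))"

text \<open>
  The last argument is the number \<open>n\<close> of letters \<open>One\<close>, so that
  \<open>restricted_partition p q L n\<close> is the bracket with upper entry \<open>L\<close> and lower entry \<open>n + 1\<close>.
\<close>

definition restricted_partition :: "real \<Rightarrow> real \<Rightarrow> nat \<Rightarrow> nat \<Rightarrow> real" where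
  "restricted_partition p q L n =
     (\<Sum>\<tau> | \<tau> \<in> Omega L n \<and> letter_at \<tau> 1 = Hat. weight p q \<tau>)"

end

theory Submission
  imports Defs
begin

text \<open>
  If \<open>n\<close> is the total number of letters \<open>One\<close>, a letter \<open>Zero\<close> preceded by \<open>k\<close> of them contributes
  \<open>(1 + n q) + k (p - q)\<close>, so the weight only depends on the left context. Let \<open>c = 1 + n q\<close> and
  \<open>d = p - q\<close>. Splitting off the first letter of a word gives the recurrence
  \<open>F c k (m + 1) = c F c k m + F (c + d) (k - 1) m\<close> for the sum over words of length \<open>m\<close> with \<open>k\<close>
  ones. It is also satisfied by the divided difference of \<open>x\<^sup>m\<close> at the nodes
  \<open>c, c + d, \<dots>, c + k d\<close>, which is the right-hand side.
\<close>

definition words :: "nat \<Rightarrow> nat \<Rightarrow> letter list set" where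
  "words m k = {u. length u = m \<and> Hat \<notin> set u \<and> count_list u One = k}"

text \<open>The product runs over all positions, with factor 1 at a \<open>One\<close>, so that
  removing the first letter is a plain index shift.\<close>

definition left_weight :: "real \<Rightarrow> real \<Rightarrow> letter list \<Rightarrow> real" where
  "left_weight d c u =
     (\<Prod>i<length u. if u ! i = Zero then c + d * real (count_list (take i u) One) else 1)"

text \<open>Lagrange form: the product of \<open>(j - i) * d\<close> over the
  \<open>i \<noteq> j\<close> up to \<open>k\<close> is
  \<open>(- 1) ^ (k - j) * fact j * fact (k - j) * d ^ k\<close>.\<close>

definition divided_difference :: "real \<Rightarrow> real \<Rightarrow> nat \<Rightarrow> nat \<Rightarrow> real" where
  "divided_difference d c k m =
     (\<Sum>j\<le>k. (- 1) ^ (k - j) / (fact j * fact (k - j)) * ((c + real j * d) ^ m / d ^ k))"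

lemma left_weight_Nil [simp]: "left_weight d c [] = 1"
  by (simp add: left_weight_def)

lemma left_weight_Zero [simp]: "left_weight d c (Zero # u) = c * left_weight d c u"
  unfolding left_weight_def by (simp add: prod.lessThan_Suc_shift del: prod.lessThan_Suc cong: if_cong)

text \<open>A leading \<open>One\<close> adds one to the count in every later prefix; the extra
  \<open>d\<close> is absorbed into \<open>c\<close>.\<close>

lemma left_weight_One [simp]: "left_weight d c (One # u) = left_weight d (c + d) u"
  unfolding left_weight_def
  by (simp add: prod.lessThan_Suc_shift algebra_simps del: prod.lessThan_Suc cong: if_cong)

lemma finite_words [simp]: "finite (words m k)"
proof (rule finite_subset)
  show "words m k \<subseteq> {u. set u \<subseteq> {Zero, One} \<and> length u = m}"
    unfolding words_def using letter.exhaust by blast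
  show "finite {u. set u \<subseteq> {Zero, One} \<and> length u = m}"
    by (rule finite_lists_length_eq) simp
qed

lemma words_0: "words 0 k = (if k = 0 then {[]} else {})"
  by (auto simp: words_def)

lemma words_Suc_0: "words (Suc m) 0 = (#) Zero ` words m 0"
proof -
  have "u \<in> (#) Zero ` words m 0" if "u \<in> words (Suc m) 0" for u
    using that by (cases u; cases "hd u") (auto simp: words_def)
  then show ?thesis by (auto simp: words_def)
qed

lemma words_Suc_Suc:
  "words (Suc m) (Suc k) = (#) Zero ` words m (Suc k) \<union> (#) One ` words m k"
proof -
  have "u \<in> (#) Zero ` words m (Suc k) \<union> (#) One ` words m k"
    if "u \<in> words (Suc m) (Suc k)" for u
    using that by (cases u; cases "hd u") (auto simp: words_def)
  then show ?thesis by (auto simp: words_def)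
qed

text \<open>Pulling out \<open>1 / (fact k * d ^ k)\<close> leaves the binomial expansion of
  \<open>(1 - 1) ^ k\<close>.\<close>

lemma divided_difference_0: "divided_difference d c k 0 = (if k = 0 then 1 else 0)"
proof (cases "k = 0")
  case False
  have "divided_difference d c k 0 =
    (\<Sum>j\<le>k. of_nat (k choose j) * 1 ^ j * (- 1) ^ (k - j)) / (fact k * d ^ k)"
    unfolding divided_difference_def sum_divide_distrib
    by (intro sum.cong refl) (simp add: binomial_fact)
  also have "\<dots> = 0"
    using False binomial_ring[of 1 "- 1 :: real" k] by (simp add: power_0_left)
  finally show ?thesis using False by simp
qed (simp add: divided_difference_def)

lemma divided_difference_Suc_0:
  "divided_difference d c 0 (Suc m) = c * divided_difference d c 0 m"
  by (simp add: divided_difference_def)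

text \<open>One factor \<open>c + j * d\<close> of the power is split off. Its part
  \<open>j * d\<close> kills the term \<open>j = 0\<close> and cancels against \<open>fact j\<close>
  and one power of \<open>d\<close>; shifting \<open>j\<close> then moves the first node to
  \<open>c + d\<close>.\<close>

lemma divided_difference_Suc_Suc:
  assumes "d \<noteq> 0"
  shows "divided_difference d c (Suc k) (Suc m) =
    c * divided_difference d c (Suc k) m + divided_difference d (c + d) k m"
proof -
  define t where "t j = (- 1) ^ (Suc k - j) / (fact j * fact (Suc k - j))
    * ((c + real j * d) ^ m / d ^ Suc k)" for j
  have "divided_difference d c (Suc k) (Suc m) = (\<Sum>j\<le>Suc k. c * t j + real j * d * t j)"
    unfolding divided_difference_def t_def
    by (intro sum.cong refl) (simp add: algebra_simps add_divide_distrib)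
  also have "\<dots> = c * divided_difference d c (Suc k) m + (\<Sum>j\<le>Suc k. real j * d * t j)"
    by (simp only: sum.distrib sum_distrib_left divided_difference_def t_def)
  also have "(\<Sum>j\<le>Suc k. real j * d * t j) = (\<Sum>j\<le>k. real (Suc j) * d * t (Suc j))"
    by (simp add: sum.atMost_Suc_shift del: sum.atMost_Suc)
  also have "\<dots> = divided_difference d (c + d) k m"
    unfolding divided_difference_def
  proof (intro sum.cong refl)
    fix j
    have "c + real (Suc j) * d = c + d + real j * d"
      by (simp add: algebra_simps)
    moreover have "real (Suc j) * d * (x / (fact (Suc j) * y) * (z / d ^ Suc k)) =
        x / (fact j * y) * (z / d ^ k)" for x y z :: real
      using assms by (simp del: of_nat_Suc)
    ultimately show "real (Suc j) * d * t (Suc j) =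
        (- 1) ^ (k - j) / (fact j * fact (k - j)) * ((c + d + real j * d) ^ m / d ^ k)"
      unfolding t_def diff_Suc_Suc by (simp only:)
  qed
  finally show ?thesis .
qed

text \<open>Both sides satisfy the same recurrence in the first letter. The induction leaves
  \<open>c\<close> and \<open>k\<close> arbitrary because a leading \<open>One\<close> changes
  both.\<close>

lemma sum_left_weight:
  assumes "d \<noteq> 0"
  shows "(\<Sum>u\<in>words m k. left_weight d c u) = divided_difference d c k m"
proof (induction m arbitrary: c k)
  case 0
  show ?case by (simp add: words_0 divided_difference_0)
next
  case (Suc m)
  show ?case
  proof (cases k)
    case 0
    then show ?thesis
      by (simp add: words_Suc_0 sum.reindex divided_difference_Suc_0 flip: sum_distrib_left Suc.IH)
  next
    case (Suc k')
    have "(\<Sum>u\<in>words (Suc m) (Suc k'). left_weight d c u) =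
        (\<Sum>u\<in>(#) Zero ` words m (Suc k'). left_weight d c u)
        + (\<Sum>u\<in>(#) One ` words m k'. left_weight d c u)"
      unfolding words_Suc_Suc by (rule sum.union_disjoint) auto
    then show ?thesis
      using assms Suc
      by (simp add: sum.reindex divided_difference_Suc_Suc flip: sum_distrib_left Suc.IH)
  qed
qed

lemma count_list_conv_card: "count_list xs x = card {i. i < length xs \<and> xs ! i = x}"
  by (simp add: count_list_eq_length_filter length_filter_conv_card eq_commute)

text \<open>Index \<open>i\<close> of \<open>u\<close>, counted from 0, is position
  \<open>i + 2\<close> of \<open>Hat # u\<close>, counted from 1.\<close>

lemma ones_before_Hat_Cons:
  assumes "i < length u"
  shows "ones_before (Hat # u) (i + 2) = count_list (take i u) One"
proof -
  have "{k. 2 \<le> k \<and> k \<le> i + 2 - 1 \<and> letter_at (Hat # u) k = One} =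
      (\<lambda>k. k + 2) ` {k. k < length (take i u) \<and> take i u ! k = One}" (is "?A = ?f ` ?B")
  proof (intro set_eqI iffI)
    fix k assume "k \<in> ?A"
    with assms have "k = ?f (k - 2)" "k - 2 \<in> ?B"
      by (auto simp: letter_at_def nth_Cons' numeral_2_eq_2)
    then show "k \<in> ?f ` ?B" by blast
  qed (use assms in \<open>auto simp: letter_at_def\<close>)
  then show ?thesis
    by (simp add: ones_before_def count_list_conv_card card_image inj_on_def)
qed

lemma ones_after_Hat_Cons:
  "ones_after (Hat # u) (i + 2) = count_list (drop (Suc i) u) One"
proof -
  \<comment> \<open>Index \<open>k\<close> after the drop is index \<open>k + i + 1\<close> of
    \<open>u\<close>, hence position \<open>k + i + 3\<close> of the word.\<close>
  have "{k. i + 2 + 1 \<le> k \<and> k \<le> length (Hat # u) \<and> letter_at (Hat # u) k = One} =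
      (\<lambda>k. k + i + 3) ` {k. k < length (drop (Suc i) u) \<and> drop (Suc i) u ! k = One}"
    (is "?A = ?f ` ?B")
  proof (intro set_eqI iffI)
    fix k assume k: "k \<in> ?A"
    then have "k = ?f (k - (i + 3))" by auto
    moreover have "k - (i + 3) \<in> ?B"
    proof -
      obtain l where "k = l + i + 3"
        using \<open>k = ?f (k - (i + 3))\<close> by blast
      with k show ?thesis by (auto simp: letter_at_def algebra_simps)
    qed
    ultimately show "k \<in> ?f ` ?B" by blast
  qed (auto simp: letter_at_def algebra_simps)
  then show ?thesis
    by (simp add: ones_after_def count_list_conv_card card_image inj_on_def)
qed

text \<open>With \<open>N\<close> ones in total and \<open>a\<close> of them before a
  \<open>Zero\<close>, \<open>N - a\<close> come after it, and
  \<open>1 + p * a + q * (N - a) = (1 + q * N) + (p - q) * a\<close>.\<close>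

lemma weight_Hat_Cons:
  "weight p q (Hat # u) = left_weight (p - q) (1 + q * real (count_list u One)) u"
proof -
  let ?I = "{i. i < length u \<and> u ! i = Zero}"
  have I: "{i. 2 \<le> i \<and> i \<le> length (Hat # u) \<and> letter_at (Hat # u) i = Zero} =
      (\<lambda>i. i + 2) ` ?I" (is "?A = ?f ` _")
  proof (intro set_eqI iffI)
    fix k assume "k \<in> ?A"
    then have "k = ?f (k - 2)" "k - 2 \<in> ?I"
      by (auto simp: letter_at_def nth_Cons' numeral_2_eq_2)
    then show "k \<in> ?f ` ?I" by blast
  qed (auto simp: letter_at_def)
  have "weight p q (Hat # u) = (\<Prod>i\<in>?I. 1 + p * real (count_list (take i u) One)
      + q * real (count_list (drop (Suc i) u) One))"
    unfolding weight_def I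
    by (subst prod.reindex) (auto simp del: add_2_eq_Suc' simp: ones_before_Hat_Cons ones_after_Hat_Cons)
  also have "\<dots> = (\<Prod>i\<in>?I. 1 + q * real (count_list u One)
      + (p - q) * real (count_list (take i u) One))"
  proof (intro prod.cong refl)
    fix i assume i: "i \<in> ?I"
    then have "u = take i u @ Zero # drop (Suc i) u"
      using id_take_nth_drop[of i u] by simp
    then have "count_list u One = count_list (take i u @ Zero # drop (Suc i) u) One"
      by (rule arg_cong)
    then have "count_list u One = count_list (take i u) One + count_list (drop (Suc i) u) One"
      by simp
    then show "1 + p * real (count_list (take i u) One)
        + q * real (count_list (drop (Suc i) u) One) =
        1 + q * real (count_list u One) + (p - q) * real (count_list (take i u) One)"
      by (simp add: algebra_simps)
  qed
  also have "\<dots> = left_weight (p - q) (1 + q * real (count_list u One)) u"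
    \<comment> \<open>The positions outside \<open>?I\<close> contribute the factor 1.\<close>
    unfolding left_weight_def by (rule prod.mono_neutral_cong_left) auto
  finally show ?thesis .
qed

text \<open>This recovers the number of letters \<open>Zero\<close>, which \<open>Omega\<close>
  prescribes and \<open>words\<close> leaves implicit in the length.\<close>

lemma length_eq_count_letters:
  "length u = count_list u Zero + count_list u One + count_list u Hat"
proof (induction u)
  case (Cons a u)
  then show ?case by (cases a) auto
qed simp

lemma Omega_Hat_first:
  assumes "n < L"
  shows "{\<tau>. \<tau> \<in> Omega L n \<and> letter_at \<tau> 1 = Hat} = (#) Hat ` words (L - 1) n"
proof (intro set_eqI iffI)
  fix \<tau> assume \<tau>: "\<tau> \<in> {\<tau>. \<tau> \<in> Omega L n \<and> letter_at \<tau> 1 = Hat}"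
  then obtain a u where "\<tau> = a # u"
    using assms by (cases \<tau>) (auto simp: Omega_def)
  with \<tau> show "\<tau> \<in> (#) Hat ` words (L - 1) n"
    by (auto simp: Omega_def words_def letter_at_def count_list_0_iff)
next
  fix \<tau> assume "\<tau> \<in> (#) Hat ` words (L - 1) n"
  then obtain u where "\<tau> = Hat # u" "u \<in> words (L - 1) n" by blast
  with assms show "\<tau> \<in> {\<tau>. \<tau> \<in> Omega L n \<and> letter_at \<tau> 1 = Hat}"
    using length_eq_count_letters[of u]
    by (auto simp: Omega_def words_def letter_at_def)
qed

theorem corollary3p5:
  fixes p q :: real and L n :: nat
  assumes "0 \<le> q" and "q < p" and "p \<le> 1" and "n < L"
  shows "restricted_partition p q L n =
    (\<Sum>j=0..n. (- 1) ^ (n - j) / (fact j * fact (n - j))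
       * ((1 + real j * p + real (n - j) * q) ^ (L - 1) / (p - q) ^ n))"
proof -
  have "restricted_partition p q L n = (\<Sum>u\<in>words (L - 1) n. weight p q (Hat # u))"
    unfolding restricted_partition_def Omega_Hat_first[OF assms(4)]
    by (simp add: sum.reindex)
  also have "\<dots> = (\<Sum>u\<in>words (L - 1) n. left_weight (p - q) (1 + q * real n) u)"
    by (intro sum.cong refl) (simp add: weight_Hat_Cons words_def)
  also have "\<dots> = divided_difference (p - q) (1 + q * real n) n (L - 1)"
    using assms by (intro sum_left_weight) simp
  also have "\<dots> = (\<Sum>j=0..n. (- 1) ^ (n - j) / (fact j * fact (n - j))
       * ((1 + real j * p + real (n - j) * q) ^ (L - 1) / (p - q) ^ n))"
    unfolding divided_difference_def atMost_atLeast0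
    \<comment> \<open>For \<open>j \<le> n\<close>, the node \<open>1 + q * n + j * (p - q)\<close>
      equals \<open>1 + j * p + (n - j) * q\<close>.\<close>
    by (intro sum.cong refl) (simp add: of_nat_diff algebra_simps)
  finally show ?thesis .
qed

end
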